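(* Let $f \in \mathbb{K}[z]$ be a polynomial of degree $n \ge 2$. Suppose there exists a vector $x \in \mathbb{K}^n$ with distinct components such that $$\left\| \frac{W_f(x)}{d(x)} \right\|_p \le \frac{R(1-R)}{1+(a-1)R}$$ for some $1 \le p \le \infty$ and $0 \le R \le 1/(1+\sqrt{a})$, where $a = (n-1)^{1/q}$ and $q$ is the conjugate exponent of $p$. In the case $n = 2$, $p = \infty$ and $R = 1/(1+\sqrt{a})$, assume that this inequality is strict. Then $f$ has only simple zeros in $\mathbb{K}$ and there exists a root-vector $\xi \in \mathbb{K}^n$ of $f$ such that $$\left\| \frac{x-\xi}{d(x)} \right\|_p \le R.$$ If the first displayed inequality is strict, then the last inequality is strict too.
   Context: $(\mathbb{K},|\cdot|)$ is an algebraically closed normed field (a field with an absolute value) and $\mathbb{K}[z]$ is the ring of polynomials over $\mathbb{K}$. For $1 \le p \le \infty$, the $p$-norm on $\mathbb{K}^n$ and on $\mathbb{R}^n$ is $\|x\|_p = \left(\sum_{i=1}^n |x_i|^p\right)^{1/p}$ ($\|x\|_\infty = \max_i |x_i|$). The conjugate exponent $q$ of $p$ is defined by $1 \le q \le \infty$ and $1/p+1/q=1$ (with $1/\infty = 0$). For $x \in \mathbb{K}^n$, $d(x) = (d_1(x),\ldots,d_n(x)) \in \mathbb{R}^n$ with $d_i(x) = \min_{j\ne i}|x_i-x_j|$. For $x \in \mathbb{K}^n$ and $y \in \mathbb{R}^n$ with no zero components, $\frac{x}{y} = \left(\frac{|x_1|}{y_1},\ldots,\frac{|x_n|}{y_n}\right)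 \in \mathbb{R}^n$. For a polynomial $f \in \mathbb{K}[z]$ of degree $n \ge 2$ with leading coefficient $a_0$ and a vector $x \in \mathbb{K}^n$ with distinct components, the Weierstrass correction is $W_f(x) = (W_1(x),\ldots,W_n(x))$ with $W_i(x) = \frac{f(x_i)}{a_0\prod_{j\ne i}(x_i-x_j)}$. A vector $\xi \in \mathbb{K}^n$ is a root-vector of $f$ if $f(z) = a_0\prod_{i=1}^n (z-\xi_i)$ for all $z \in \mathbb{K}$. *)

theory Defs
  imports "HOL-Analysis.Analysis" "HOL-Computational_Algebra.Computational_Algebra"
begin

text \<open>
  The absolute value is an explicit function rather than the norm of the class
  \<open>real_normed_field\<close>: that class requires an algebra over the reals and would exclude
  non-archimedean fields and fields of positive characteristic.
\<close>

locale absolute_value =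
  fixes v :: "'a::field \<Rightarrow> real"
  assumes nonneg: "0 \<le> v x"
    and eq_0_iff: "v x = 0 \<longleftrightarrow> x = 0"
    and mult: "v (x * y) = v x * v y"
    and triangle: "v (x + y) \<le> v x + v y"

definition p_norm :: "ereal \<Rightarrow> real ^ 'n::finite \<Rightarrow> real" where
  "p_norm p x =
     (if p = \<infinity> then Max (range (\<lambda>i. \<bar>x $ i\<bar>))
      else (\<Sum>i\<in>UNIV. \<bar>x $ i\<bar> powr real_of_ereal p) powr (1 / real_of_ereal p))"

text \<open>Division is that of \<^typ>\<open>ereal\<close>, where \<open>1 / \<infinity> = 0\<close>.\<close>

definition conjugate_exponents :: "ereal \<Rightarrow> ereal \<Rightarrow> bool" where
  "conjugate_exponents p q \<longleftrightarrow> 1 \<le> p \<and> 1 \<le> q \<and> 1 / p + 1 / q = 1"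

text \<open>The minimum is over a nonempty set as soon as there are at least two indices.\<close>

definition sep_vec :: "('a::field \<Rightarrow> real) \<Rightarrow> 'a ^ 'n::finite \<Rightarrow> real ^ 'n" where
  "sep_vec v x = (\<chi> i. Min ((\<lambda>j. v (x $ i - x $ j)) ` {j. j \<noteq> i}))"

text \<open>Meaningful only for \<open>y\<close> without zero components.\<close>

definition vec_quot :: "('a::field \<Rightarrow> real) \<Rightarrow> 'a ^ 'n::finite \<Rightarrow> real ^ 'n \<Rightarrow> real ^ 'n" where
  "vec_quot v x y = (\<chi> i. v (x $ i) / y $ i)"

text \<open>Meaningful only for \<open>x\<close> with distinct components.\<close>

definition weierstrass_corr :: "'a::field poly \<Rightarrow> 'a ^ 'n::finite \<Rightarrow> 'a ^ 'n" where
  "weierstrass_corr f x =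
     (\<chi> i. poly f (x $ i) / (lead_coeff f * (\<Prod>j\<in>UNIV - {i}. x $ i - x $ j)))"

definition root_vector :: "'a::field poly \<Rightarrow> 'a ^ 'n::finite \<Rightarrow> bool" where
  "root_vector f \<xi> \<longleftrightarrow> (\<forall>z. poly f z = lead_coeff f * (\<Prod>i\<in>UNIV. z - \<xi> $ i))"

end

theory Submission
  imports Defs
begin

text \<open>
  Write \<open>W\<close> for the Weierstrass correction, \<open>d\<close> for the separation vector and \<open>w i = |W i| / d i\<close>.
  Lagrange interpolation at the nodes gives, for \<open>z\<close> different from the other nodes,
  \<open>f z = c (\<Prod>j\<noteq>i. z - x j) ((z - x i) D z + W i)\<close> with \<open>D z = 1 + (\<Sum>j\<noteq>i. W j / (z - x j))\<close>
  and \<open>c\<close> the leading coefficient (lemma \<open>poly_eq_node_factorization\<close>). Hence the roots of \<open>f\<close> near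
  \<open>x i\<close> are the fixed points of \<open>z \<mapsto> x i - W i / D z\<close>, a map of one variable for each node.

  Let \<open>e\<close> be the \<open>p\<close>-norm of \<open>w\<close>. By Hoelder's inequality \<open>(\<Sum>j\<noteq>i. w j) \<le> a e\<close>, and for
  \<open>|z - x i| \<le> r d i\<close> this yields \<open>|D z| \<ge> 1 - a e / (1 - r)\<close>. So the map sends the disc of relative
  radius \<open>r\<close> into that of relative radius \<open>e / (1 - a e / (1 - r))\<close>. Rearranged, the
  bound assumed for \<open>e\<close> is \<open>e \<le> R (1 - a e / (1 - R))\<close>, so that radius \<open>R\<close> goes to a radius of at
  most \<open>R\<close> (lemma \<open>majorant_bound\<close>). Iterating from
  \<open>x i\<close>, the steps are dominated by those of the scalar iteration of this radius map from \<open>0\<close>,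
  which is increasing and bounded by \<open>R\<close>; therefore \<open>f\<close> tends to \<open>0\<close> along the iteration
  (lemma \<open>majorized_iteration\<close>). That the steps are summable does not give a limit, as the field
  may be incomplete; but it contains all roots of \<open>f\<close>, and they are finitely many, so one of them
  lies in the disc of relative radius \<open>R\<close>
  (lemma \<open>root_in_disc_of_values_tendsto_zero\<close>).

  The fixed point equation bounds the relative error of this root by \<open>w i / (1 - a e / (1 - R))\<close>.
  Taking \<open>p\<close>-norms gives the bound \<open>R\<close>, strictly if the bound on \<open>e\<close> is strict. Roots found for
  different nodes are distinct, because two relative errors add up to less than \<open>1\<close>: since
  \<open>R \<le> 1 / (1 + sqrt a) \<le> 1 / 2\<close>, the only exception could be two errors equal to \<open>1 / 2\<close>, which
  forces \<open>p = \<infinity>\<close>, \<open>a = 1\<close> and so \<open>n = 2\<close>, where the inequality is assumed strict. Thus \<open>n\<close> distinct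
  roots have been found, and \<open>f\<close> splits into simple linear factors.
\<close>

section \<open>The \<open>p\<close>-norm\<close>

lemma p_norm_ereal:
  "p_norm (ereal P) u = (\<Sum>i\<in>UNIV. \<bar>u $ i\<bar> powr P) powr (1 / P)"
  by (simp add: p_norm_def)

lemma abs_component_le_p_norm_infinity:
  fixes u :: "real ^ 'n::finite"
  shows "\<bar>u $ i\<bar> \<le> p_norm \<infinity> u"
  by (simp add: p_norm_def)

lemma p_norm_nonneg: "0 \<le> p_norm p u"
proof (cases "p = \<infinity>")
  case True
  then show ?thesis
    using abs_component_le_p_norm_infinity[of u undefined] by (smt (verit))
qed (simp add: p_norm_def)

lemma sum_powr_eq_p_norm_powr:
  fixes u :: "real ^ 'n::finite"
  assumes "1 \<le> P"
  shows "(\<Sum>i\<in>UNIV. \<bar>u $ i\<bar> powr P) = p_norm (ereal P) u powr P"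
  using assms by (simp add: p_norm_ereal powr_powr powr_one' sum_nonneg)

lemma abs_component_le_p_norm:
  fixes u :: "real ^ 'n::finite"
  assumes "1 \<le> p"
  shows "\<bar>u $ i\<bar> \<le> p_norm p u"
proof (cases p)
  case (real P)
  then have P: "1 \<le> P" using assms by simp
  have "\<bar>u $ i\<bar> = (\<bar>u $ i\<bar> powr P) powr (1 / P)"
    using P by (simp add: powr_powr)
  also have "\<dots> \<le> (\<Sum>i\<in>UNIV. \<bar>u $ i\<bar> powr P) powr (1 / P)"
    using P by (intro powr_mono2 member_le_sum) auto
  finally show ?thesis using real by (simp add: p_norm_ereal)
qed (use assms abs_component_le_p_norm_infinity[of u i] in auto)

lemma p_norm_le_mult:
  fixes u w :: "real ^ 'n::finite"
  assumes "1 \<le> p" "0 \<le> c" "\<And>i. \<bar>u $ i\<bar> \<le> c * \<bar>w $ i\<bar>"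
  shows "p_norm p u \<le> c * p_norm p w"
proof (cases p)
  case (real P)
  then have P: "1 \<le> P" using assms by simp
  have "(\<Sum>i\<in>UNIV. \<bar>u $ i\<bar> powr P) \<le> (\<Sum>i\<in>UNIV. (c * \<bar>w $ i\<bar>) powr P)"
    using P assms(3) by (intro sum_mono powr_mono2) auto
  also have "\<dots> = c powr P * (\<Sum>i\<in>UNIV. \<bar>w $ i\<bar> powr P)"
    using assms(2) by (simp add: powr_mult sum_distrib_left)
  finally have "p_norm p u \<le> (c powr P * (\<Sum>i\<in>UNIV. \<bar>w $ i\<bar> powr P)) powr (1 / P)"
    using P real by (auto simp: p_norm_ereal intro!: powr_mono2 sum_nonneg)
  also have "\<dots> = c * p_norm p w"
    using P real assms(2) by (simp add: p_norm_ereal powr_mult sum_nonneg powr_powr)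
  finally show ?thesis .
next
  case PInf
  have "\<bar>u $ i\<bar> \<le> c * p_norm p w" for i
    using mult_left_mono[OF abs_component_le_p_norm[OF assms(1), of w i] assms(2)] assms(3)[of i]
    by linarith
  then show ?thesis using PInf by (simp add: p_norm_def)
qed (use assms in auto)

lemma conjugate_exponent_inverse:
  assumes "conjugate_exponents p q"
  shows "real_of_ereal (1 / q) = 1 - real_of_ereal (1 / p)"
  using assms unfolding conjugate_exponents_def
  by (cases p; cases q) (auto simp: one_ereal_def zero_ereal_def divide_ereal_def split: if_splits)

text \<open>
  Hoelder's inequality against the constant vector: Young's inequality is applied to each
  \<open>w j / e\<close> and the constant \<open>N powr (-1 / Q)\<close>, where \<open>N = card J\<close> and \<open>1 / P + 1 / Q = 1\<close>. With this
  constant the \<open>N\<close> terms bounding its powers add up to \<open>1 / Q\<close>.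
\<close>

lemma sum_le_card_powr_mult:
  fixes w :: "'b \<Rightarrow> real"
  assumes "finite J" "J \<noteq> {}" "1 < P" "0 \<le> e" "\<And>j. j \<in> J \<Longrightarrow> 0 \<le> w j"
    and le: "(\<Sum>j\<in>J. w j powr P) \<le> e powr P"
  shows "(\<Sum>j\<in>J. w j) \<le> real (card J) powr (1 - 1 / P) * e"
proof (cases "e = 0")
  case True
  have "(\<Sum>j\<in>J. w j powr P) \<le> 0" using le True by simp
  then have "w j powr P = 0" if "j \<in> J" for j
    using member_le_sum[OF that, of "\<lambda>j. w j powr P"] powr_ge_zero[of "w j" P] assms(1)
    by (meson order_antisym order_trans powr_ge_zero)
  then have "w j = 0" if "j \<in> J" for j
    using that by simp
  then show ?thesis using True by simp
next
  case False
  then have e: "0 < e" using assms by simp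
  define N Q l where "N = real (card J)" and "Q = 1 / (1 - 1 / P)" and "l = N powr (- 1 / Q)"
  have N: "0 < N" using assms by (simp add: N_def card_gt_0_iff)
  have Q: "1 < Q" "1 / P + 1 / Q = 1" using assms(3) by (simp_all add: Q_def field_simps)
  have "(\<Sum>j\<in>J. w j / e * l) \<le> (\<Sum>j\<in>J. (w j / e) powr P / P + l powr Q / Q)"
    using assms e Q by (intro sum_mono Youngs_inequality) (auto simp: l_def)
  also have "\<dots> = (\<Sum>j\<in>J. w j powr P) / e powr P / P + N * l powr Q / Q"
    using assms e by (simp add: sum.distrib powr_divide N_def sum_divide_distrib)
  also have "\<dots> \<le> 1 / P + 1 / Q"
  proof -
    have "l powr Q = N powr (- 1 / Q * Q)"
      by (simp only: l_def powr_powr)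
    then have "l powr Q = 1 / N"
      using Q N by (simp add: powr_neg_one)
    moreover have "(\<Sum>j\<in>J. w j powr P) / e powr P \<le> 1"
      using le e by simp
    ultimately show ?thesis
      using N assms(3) divide_right_mono[of "(\<Sum>j\<in>J. w j powr P) / e powr P" 1 P] by simp
  qed
  finally have "(\<Sum>j\<in>J. w j) * (l / e) \<le> 1"
    using Q by (simp add: sum_distrib_right sum_divide_distrib)
  then have "(\<Sum>j\<in>J. w j) \<le> e / l"
    using e N by (simp add: l_def field_simps)
  also have "\<dots> = N powr (1 / Q) * e"
    by (simp add: l_def powr_minus field_simps)
  finally show ?thesis by (simp add: N_def Q_def)
qed

lemma sum_other_components_le_p_norm:
  fixes w :: "real ^ 'n::finite"
  assumes "1 \<le> p" "conjugate_exponents p q" "2 \<le> CARD('n)"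
  shows "(\<Sum>j\<in>UNIV - {i}. \<bar>w $ j\<bar>) \<le> (real CARD('n) - 1) powr real_of_ereal (1 / q) * p_norm p w"
proof -
  define J where "J = UNIV - {i}"
  have card: "real (card J) = real CARD('n) - 1"
    using assms(3) by (simp add: J_def card_Diff_singleton of_nat_diff)
  have ne: "J \<noteq> {}" using card assms(3) by auto
  have q: "real_of_ereal (1 / q) = 1 - real_of_ereal (1 / p)"
    by (rule conjugate_exponent_inverse[OF assms(2)])
  have "(\<Sum>j\<in>J. \<bar>w $ j\<bar>) \<le> real (card J) powr real_of_ereal (1 / q) * p_norm p w"
  proof (cases p)
    case PInf
    have "(\<Sum>j\<in>J. \<bar>w $ j\<bar>) \<le> real (card J) * p_norm p w"
      by (rule sum_bounded_above) (rule abs_component_le_p_norm[OF assms(1)])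
    then show ?thesis using q PInf by simp
  next
    case (real P)
    then have P: "1 \<le> P" using assms by simp
    have 1: "real_of_ereal (1 / q) = 1 - 1 / P" using q real P
      by (simp add: one_ereal_def)
    have le: "(\<Sum>j\<in>J. \<bar>w $ j\<bar> powr P) \<le> p_norm p w powr P"
      unfolding real sum_powr_eq_p_norm_powr[OF P, symmetric] by (intro sum_mono2) auto
    show ?thesis
    proof (cases "P = 1")
      case True
      then show ?thesis using le ne 1 p_norm_nonneg[of p w] by (simp add: powr_one' card_gt_0_iff)
    next
      case False
      then show ?thesis
        unfolding 1 using P le ne p_norm_nonneg by (intro sum_le_card_powr_mult) auto
    qed
  qed (use assms in auto)
  then show ?thesis unfolding card by (simp only: J_def)
qed

text \<open>Only the maximum norm lets two nonzero components of a vector both be as large as its norm.\<close>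

lemma p_norm_gt_of_two_components:
  fixes u :: "real ^ 'n::finite"
  assumes "1 \<le> p" "p \<noteq> \<infinity>" "i \<noteq> j" "0 < c" "c \<le> \<bar>u $ i\<bar>" "c \<le> \<bar>u $ j\<bar>"
  shows "c < p_norm p u"
proof (cases p)
  case (real P)
  then have P: "1 \<le> P" using assms by simp
  have "c powr P < c powr P + c powr P" using assms by simp
  also have "\<dots> \<le> \<bar>u $ i\<bar> powr P + \<bar>u $ j\<bar> powr P"
    using assms P by (intro add_mono powr_mono2) auto
  also have "\<dots> = (\<Sum>k\<in>{i, j}. \<bar>u $ k\<bar> powr P)" using assms by simp
  also have "\<dots> \<le> p_norm p u powr P"
    unfolding real sum_powr_eq_p_norm_powr[OF P, symmetric] by (intro sum_mono2) auto
  finally show ?thesis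
    using P p_norm_nonneg[of p u] assms by (smt (verit) powr_mono2)
qed (use assms in auto)

section \<open>Absolute values and polynomials\<close>

context absolute_value
begin

lemma one: "v 1 = 1"
  using mult[of 1 1] eq_0_iff[of 1] by simp

lemma minus: "v (- x) = v x"
proof -
  have "v (- 1) * v (- 1) = 1" using mult[of "- 1" "- 1"] one by simp
  then have "v (- 1) = 1" using nonneg[of "- 1"] by (simp add: square_eq_1_iff)
  then show ?thesis using mult[of "- 1" x] by simp
qed

lemma minus_commute: "v (x - y) = v (y - x)"
  using minus[of "x - y"] by simp

lemma triangle_sub: "v x - v y \<le> v (x + y)"
  using triangle[of "x + y" "- y"] minus[of y] by simp

lemma triangle_diff: "v (x - z) \<le> v (x - y) + v (y - z)"
  using triangle[of "x - y" "y - z"] by simp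

lemma divide: "v (x / y) = v x / v y"
proof (cases "y = 0")
  case True
  then show ?thesis using eq_0_iff[of 0] by simp
next
  case False
  then show ?thesis using mult[of "x / y" y] eq_0_iff[of y] by (simp add: field_simps)
qed

lemma sum_le: "v (sum g A) \<le> (\<Sum>i\<in>A. v (g i))"
proof (induction A rule: infinite_finite_induct)
  case (insert a A)
  then show ?case using triangle[of "g a" "sum g A"] by simp
qed (use eq_0_iff[of 0] in auto)

lemma prod: "v (prod g A) = (\<Prod>i\<in>A. v (g i))"
  by (induction A rule: infinite_finite_induct) (auto simp: one mult)

end

text \<open>Each of the linear factors into which \<open>f\<close> splits contributes at least \<open>\<delta>\<close>.\<close>

lemma poly_ge_of_far_from_roots:
  fixes v :: "'a::alg_closed_field \<Rightarrow> real"
  assumes "absolute_value v" "0 \<le> \<delta>" "f \<noteq> 0"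
    and far: "\<And>\<zeta>. poly f \<zeta> = 0 \<Longrightarrow> \<delta> \<le> v (z - \<zeta>)"
  shows "v (lead_coeff f) * \<delta> ^ degree f \<le> v (poly f z)"
proof -
  interpret absolute_value v by fact
  obtain A where A: "size A = degree f" "f = smult (lead_coeff f) (\<Prod>\<zeta>\<in>#A. [:-\<zeta>, 1:])"
    using alg_closed_imp_factorization[OF assms(3)] by blast
  have ev: "poly f u = lead_coeff f * (\<Prod>\<zeta>\<in>#A. u - \<zeta>)" for u
    by (subst A(2)) (simp add: poly_prod_mset)
  have "poly f \<zeta> = 0" if "\<zeta> \<in># A" for \<zeta>
    using that by (auto simp: ev)
  then have "\<delta> ^ size B \<le> v (\<Prod>\<zeta>\<in>#B. z - \<zeta>)" if "B \<subseteq># A" for B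
    using that
  proof (induction B)
    case (add \<zeta> B)
    then have "\<delta> \<le> v (z - \<zeta>)" "\<delta> ^ size B \<le> v (\<Prod>\<zeta>\<in>#B. z - \<zeta>)"
      using far by (auto simp: insert_subset_eq_iff dest: mset_subset_eqD subset_mset.order_trans[OF _ diff_subset_eq_self])
    then show ?case using assms(2) nonneg by (auto simp: mult intro!: mult_mono)
  qed (simp add: one)
  from this[of A] show ?thesis
    using A(1) nonneg[of "lead_coeff f"] by (simp add: ev mult mult_left_mono)
qed

text \<open>
  The passage from approximate to exact zeros, in a field where Cauchy sequences may diverge: the
  roots are finitely many, so if all of them kept away from the disc, the polynomial would be
  bounded below on it.
\<close>

lemma root_in_disc_of_values_tendsto_zero:
  fixes v :: "'a::alg_closed_field \<Rightarrow> real"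
  assumes "absolute_value v" "f \<noteq> 0"
    and disc: "\<And>k. v (t k - c) \<le> \<rho>"
    and lim: "(\<lambda>k. v (poly f (t k))) \<longlonglongrightarrow> 0"
  shows "\<exists>\<zeta>. poly f \<zeta> = 0 \<and> v (\<zeta> - c) \<le> \<rho>"
proof (rule ccontr)
  interpret absolute_value v by fact
  assume no_root: "\<nexists>\<zeta>. poly f \<zeta> = 0 \<and> v (\<zeta> - c) \<le> \<rho>"
  define Z where "Z = {\<zeta>. poly f \<zeta> = 0}"
  have fin: "finite Z" unfolding Z_def by (rule poly_roots_finite[OF assms(2)])
  \<comment> \<open>The number 1 only keeps the set nonempty when there are no roots.\<close>
  define \<delta> where "\<delta> = Min (insert 1 ((\<lambda>\<zeta>. v (\<zeta> - c) - \<rho>) ` Z))"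
  have \<delta>: "0 < \<delta>" unfolding \<delta>_def using fin no_root
    by (subst Min_gr_iff) (auto simp: Z_def)
  have "\<delta> \<le> v (t k - \<zeta>)" if "poly f \<zeta> = 0" for k \<zeta>
  proof -
    have "\<delta> \<le> v (\<zeta> - c) - \<rho>"
      unfolding \<delta>_def using fin that by (intro Min_le) (auto simp: Z_def)
    then show ?thesis
      using triangle_diff[of \<zeta> c "t k"] disc[of k] minus_commute[of \<zeta> "t k"] by linarith
  qed
  then have "v (lead_coeff f) * \<delta> ^ degree f \<le> v (poly f (t k))" for k
    using \<delta> assms by (intro poly_ge_of_far_from_roots) auto
  then have "v (lead_coeff f) * \<delta> ^ degree f \<le> 0"
    using lim by (intro LIMSEQ_le_const) auto
  moreover have "0 < v (lead_coeff f)"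
    using assms(2) nonneg[of "lead_coeff f"] eq_0_iff[of "lead_coeff f"] by (simp add: less_le)
  ultimately show False using zero_less_power[OF \<delta>, of "degree f"] by (simp add: mult_le_0_iff)
qed

lemma eq_prod_of_distinct_roots:
  fixes f :: "'a::field poly" and \<xi> :: "'a ^ 'n::finite"
  assumes "degree f = CARD('n)" "inj (\<lambda>i. \<xi> $ i)" "\<And>i. poly f (\<xi> $ i) = 0"
  shows "f = smult (lead_coeff f) (\<Prod>i\<in>UNIV. [:- (\<xi> $ i), 1:])"
proof -
  have deg: "degree (\<Prod>i\<in>UNIV. [:- (\<xi> $ i), 1:]) = CARD('n)"
    by (simp add: degree_prod_sum_eq)
  moreover have "lead_coeff (\<Prod>i\<in>UNIV. [:- (\<xi> $ i), 1:]) = 1"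
    by (simp add: lead_coeff_prod)
  ultimately show ?thesis
    using assms
    by (intro poly_eqI_degree_lead_coeff[where n = "CARD('n)" and A = "range (\<lambda>i. \<xi> $ i)"])
      (auto simp: card_image poly_prod prod_zero_iff)
qed

lemma distinct_roots_root_vector_simple:
  fixes f :: "'a::field poly" and \<xi> :: "'a ^ 'n::finite"
  assumes "degree f = CARD('n)" "inj (\<lambda>i. \<xi> $ i)" "\<And>i. poly f (\<xi> $ i) = 0"
  shows "root_vector f \<xi>" and "poly f z = 0 \<Longrightarrow> order z f = 1"
proof -
  note f = eq_prod_of_distinct_roots[OF assms]
  have ev: "poly f u = lead_coeff f * (\<Prod>i\<in>UNIV. u - \<xi> $ i)" for u
    by (subst f) (simp add: poly_prod)
  then show "root_vector f \<xi>" by (simp add: root_vector_def)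
  assume z: "poly f z = 0"
  have "f \<noteq> 0" using assms(1) by auto
  then have lc: "lead_coeff f \<noteq> 0" by simp
  obtain i where i: "z = \<xi> $ i"
    using z lc by (auto simp: ev)
  define h where "h = (\<Prod>j\<in>UNIV - {i}. [:- (\<xi> $ j), 1:])"
  have f': "f = smult (lead_coeff f) ([:- z, 1:] * h)"
    using f by (simp add: h_def i prod.remove[of UNIV i] del: mult_pCons_left)
  have h: "poly h z \<noteq> 0"
    using assms(2) by (auto simp: h_def poly_prod i inj_on_def)
  then have "h \<noteq> 0" by auto
  then have "order z ([:- z, 1:] * h) = order z [:- z, 1:] + order z h"
    by (intro order_mult) (simp del: mult_pCons_left)
  then have "order z f = order z [:- z, 1:] + order z h"
    by (metis f' lc order_smult)
  then show "order z f = 1" using h order_power_n_n[of z 1] by (simp add: order_0I)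
qed

section \<open>Majorized iteration\<close>

text \<open>
  The iteration is \<open>t \<mapsto> c - W / D t\<close>, started at the centre \<open>c\<close>. Its steps are dominated by
  those of the scalar iteration \<open>r \<mapsto> m / (1 - s / (1 - r))\<close> from \<open>0\<close>, which increases and stays
  below \<open>R\<close> because \<open>R\<close> is mapped to at most \<open>R\<close>. A contraction argument would not do: on the
  whole disc of radius \<open>R * d\<close> the bounds may only give a Lipschitz constant of \<open>1\<close> or more.
\<close>

lemma majorized_iteration:
  fixes v :: "'a::field \<Rightarrow> real"
  assumes "absolute_value v" and d: "0 < d" and m: "0 \<le> m" and s: "0 \<le> s" "s < 1 - R"
    and R: "0 \<le> R" "m / (1 - s / (1 - R)) \<le> R"
    and W: "v W \<le> m * d"
    and lower: "\<And>t \<tau>. 0 \<le> \<tau> \<Longrightarrow> \<tau> \<le> R \<Longrightarrow> v (t - c) \<le> \<tau> * d \<Longrightarrow> 1 - s / (1 - \<tau>) \<le> v (D t)"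
    and upper: "\<And>t. v (t - c) \<le> R * d \<Longrightarrow> v (D t) \<le> B"
    and lip: "\<And>t u \<sigma> \<tau>. \<sigma> \<le> R \<Longrightarrow> \<tau> \<le> R \<Longrightarrow> v (t - c) \<le> \<sigma> * d \<Longrightarrow> v (u - c) \<le> \<tau> * d
      \<Longrightarrow> v (D u - D t) \<le> s * v (u - t) / ((1 - \<sigma>) * (1 - \<tau>) * d)"
  shows "\<exists>t :: nat \<Rightarrow> 'a. (\<forall>k. v (t k - c) \<le> R * d) \<and>
    (\<lambda>k. v ((t k - c) * D (t k) + W)) \<longlonglongrightarrow> 0"
proof -
  interpret absolute_value v by fact
  define h where "h = (\<lambda>r. 1 - s / (1 - r))"
  define g where "g = (\<lambda>r. m / h r)"
  define t where "t = (\<lambda>k. ((\<lambda>t. c - W / D t) ^^ k) c)"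
  define r where "r = (\<lambda>k. (g ^^ k) 0)"
  have t_Suc: "t (Suc k) = c - W / D (t k)" and r_Suc: "r (Suc k) = g (r k)" for k
    by (simp_all add: t_def r_def)
  have R1: "R < 1" using s by linarith
  have h_pos: "0 < h \<tau>" if "\<tau> \<le> R" for \<tau>
    using that s R1 by (simp add: h_def)
  have h_anti: "h \<tau> \<le> h \<sigma>" if "\<sigma> \<le> \<tau>" "\<tau> \<le> R" for \<sigma> \<tau>
    using that s R1 by (auto simp: h_def intro!: divide_left_mono)
  have g_mono: "g \<sigma> \<le> g \<tau>" if "\<sigma> \<le> \<tau>" "\<tau> \<le> R" for \<sigma> \<tau>
    unfolding g_def using that h_pos h_anti m by (intro divide_left_mono) auto
  have g_R: "g R \<le> R" using R by (simp add: g_def h_def)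
  have g_nonneg: "0 \<le> g \<tau>" if "\<tau> \<le> R" for \<tau>
    unfolding g_def using m h_pos[OF that] by simp
  \<comment> \<open>The difference of consecutive majorants has exactly the form of the Lipschitz bound.\<close>
  have g_diff: "g \<tau> - g \<sigma> = m * (s * (\<tau> - \<sigma>) / ((1 - \<sigma>) * (1 - \<tau>))) / (h \<sigma> * h \<tau>)"
    if "\<sigma> \<le> R" "\<tau> \<le> R" for \<sigma> \<tau>
  proof -
    have "g \<tau> - g \<sigma> = m * (h \<sigma> - h \<tau>) / (h \<sigma> * h \<tau>)"
      using h_pos[OF that(1)] h_pos[OF that(2)] by (simp add: g_def field_simps)
    also have "h \<sigma> - h \<tau> = s * (\<tau> - \<sigma>) / ((1 - \<sigma>) * (1 - \<tau>))"
      using that R1 by (simp add: h_def field_simps)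
    finally show ?thesis .
  qed
  have D_lower: "h \<tau> \<le> v (D u)" if "0 \<le> \<tau>" "\<tau> \<le> R" "v (u - c) \<le> \<tau> * d" for \<tau> u
    using lower[OF that] by (simp add: h_def)
  have image: "v ((c - W / D u) - c) \<le> g \<tau> * d" if "0 \<le> \<tau>" "\<tau> \<le> R" "v (u - c) \<le> \<tau> * d" for \<tau> u
  proof -
    have "v ((c - W / D u) - c) = v W / v (D u)"
      by (simp add: minus divide)
    also have "\<dots> \<le> (m * d) / h \<tau>"
      using W D_lower[OF that] h_pos[OF that(2)] nonneg m d by (intro frac_le) auto
    finally show ?thesis by (simp add: g_def)
  qed
  have inv: "0 \<le> r k \<and> r k \<le> r (Suc k) \<and> r (Suc k) \<le> R \<and> v (t k - c) \<le> r k * d \<and>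
      v (t (Suc k) - t k) \<le> (r (Suc k) - r k) * d" for k
  proof (induction k)
    case 0
    have "r 0 = 0" "t 0 = c" by (simp_all add: r_def t_def)
    then show ?case
      using image[of 0 c] g_nonneg[of 0] g_mono[of 0 R] g_R R eq_0_iff[of 0]
      by (simp add: t_Suc r_Suc)
  next
    case (Suc k)
    define \<sigma> \<tau> where "\<sigma> = r k" and "\<tau> = r (Suc k)"
    have \<sigma>\<tau>: "0 \<le> \<sigma>" "\<sigma> \<le> \<tau>" "\<tau> \<le> R" "\<sigma> \<le> R" "0 \<le> \<tau>"
      and t: "v (t k - c) \<le> \<sigma> * d" and step: "v (t (Suc k) - t k) \<le> (\<tau> - \<sigma>) * d"
      using Suc by (auto simp: \<sigma>_def \<tau>_def)
    have t': "v (t (Suc k) - c) \<le> \<tau> * d"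
      using image[OF \<sigma>\<tau>(1,4) t] by (simp add: t_Suc \<tau>_def r_Suc \<sigma>_def)
    note Dk = D_lower[OF \<sigma>\<tau>(1,4) t] and Dk' = D_lower[OF \<sigma>\<tau>(5,3) t']
    note pos = h_pos[OF \<sigma>\<tau>(4)] h_pos[OF \<sigma>\<tau>(3)]
    have "0 < v (D (t k))" "0 < v (D (t (Suc k)))"
      using Dk Dk' pos by linarith+
    then have nz: "D (t k) \<noteq> 0" "D (t (Suc k)) \<noteq> 0"
      using eq_0_iff[of 0] by auto
    have "t (Suc (Suc k)) - t (Suc k) = (c - W / D (t (Suc k))) - (c - W / D (t k))"
      by (simp only: t_Suc)
    also have "\<dots> = W * (D (t (Suc k)) - D (t k)) / (D (t k) * D (t (Suc k)))"
      using nz by (simp add: field_simps)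
    finally have "t (Suc (Suc k)) - t (Suc k)
        = W * (D (t (Suc k)) - D (t k)) / (D (t k) * D (t (Suc k)))" .
    then have "v (t (Suc (Suc k)) - t (Suc k))
        = v W * v (D (t (Suc k)) - D (t k)) / (v (D (t k)) * v (D (t (Suc k))))"
      by (simp add: divide mult)
    also have "\<dots> \<le> (m * d) * (s * (\<tau> - \<sigma>) / ((1 - \<sigma>) * (1 - \<tau>))) / (h \<sigma> * h \<tau>)"
    proof -
      have "v (D (t (Suc k)) - D (t k))
          \<le> s * v (t (Suc k) - t k) / ((1 - \<sigma>) * (1 - \<tau>) * d)"
        by (rule lip[OF \<sigma>\<tau>(4,3) t t'])
      also have "\<dots> \<le> s * ((\<tau> - \<sigma>) * d) / ((1 - \<sigma>) * (1 - \<tau>) * d)"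
        using step s \<sigma>\<tau> R1 d by (intro divide_right_mono mult_left_mono) auto
      also have "\<dots> = s * (\<tau> - \<sigma>) / ((1 - \<sigma>) * (1 - \<tau>))" using d by simp
      finally have 1: "v (D (t (Suc k)) - D (t k)) \<le> s * (\<tau> - \<sigma>) / ((1 - \<sigma>) * (1 - \<tau>))" .
      then have 2: "0 \<le> s * (\<tau> - \<sigma>) / ((1 - \<sigma>) * (1 - \<tau>))"
        using nonneg order_trans by blast
      have "v W * v (D (t (Suc k)) - D (t k)) \<le> (m * d) * (s * (\<tau> - \<sigma>) / ((1 - \<sigma>) * (1 - \<tau>)))"
        using W 1 nonneg m d by (intro mult_mono) simp_all
      moreover have "h \<sigma> * h \<tau> \<le> v (D (t k)) * v (D (t (Suc k)))"
        using Dk Dk' pos nonneg by (intro mult_mono) simp_all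
      moreover have "0 \<le> (m * d) * (s * (\<tau> - \<sigma>) / ((1 - \<sigma>) * (1 - \<tau>)))"
        using 2 m d by (intro mult_nonneg_nonneg) simp_all
      ultimately show ?thesis
        using pos by (intro frac_le mult_pos_pos)
    qed
    also have "\<dots> = (g \<tau> - g \<sigma>) * d"
      unfolding g_diff[OF \<sigma>\<tau>(4,3)] by simp
    finally have "v (t (Suc (Suc k)) - t (Suc k)) \<le> (r (Suc (Suc k)) - r (Suc k)) * d"
      unfolding r_Suc by (simp add: \<sigma>_def \<tau>_def r_Suc)
    then show ?case
      using t' \<sigma>\<tau> g_mono[OF \<sigma>\<tau>(2,3)] g_mono[OF \<sigma>\<tau>(3) order_refl] g_R
      by (auto simp: \<sigma>_def \<tau>_def r_Suc)
  qed
  have ball: "v (t k - c) \<le> R * d" for k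
  proof -
    have "r k * d \<le> R * d" using inv[of k] d by (intro mult_right_mono) auto
    then show ?thesis using inv[of k] by linarith
  qed
  have "\<exists>L. r \<longlonglongrightarrow> L"
  proof -
    have "incseq r" using inv by (intro incseq_SucI) auto
    moreover have "r k \<le> R" for k using inv[of k] by auto
    ultimately show ?thesis using incseq_convergent by metis
  qed
  then obtain L where L: "r \<longlonglongrightarrow> L" by blast
  have "(\<lambda>k. r (Suc k) - r k) \<longlonglongrightarrow> L - L"
    by (intro tendsto_diff LIMSEQ_Suc L)
  then have lim: "(\<lambda>k. B * ((r (Suc k) - r k) * d)) \<longlonglongrightarrow> 0"
    using tendsto_mult_left[OF tendsto_mult_right[of _ "L - L" _ d], of _ _ B] by simp
  have bound: "v ((t k - c) * D (t k) + W) \<le> B * ((r (Suc k) - r k) * d)" for k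
  proof -
    have "r k \<le> R" using inv[of k] by auto
    then have "0 < v (D (t k))"
      using D_lower[of "r k" "t k"] inv[of k] h_pos[of "r k"] by linarith
    then have "D (t k) \<noteq> 0" using eq_0_iff[of 0] by auto
    then have "(t k - c) * D (t k) + W = D (t k) * (t k - t (Suc k))"
      by (simp add: t_Suc field_simps)
    then have "v ((t k - c) * D (t k) + W) = v (D (t k)) * v (t (Suc k) - t k)"
      by (simp add: mult minus_commute)
    also have "\<dots> \<le> B * ((r (Suc k) - r k) * d)"
      using upper[OF ball] inv[of k] nonneg by (intro mult_mono) (auto intro: order_trans)
    finally show ?thesis .
  qed
  have "(\<lambda>k. v ((t k - c) * D (t k) + W)) \<longlonglongrightarrow> 0"
    by (rule tendsto_sandwich[OF _ _ tendsto_const lim]) (auto simp: bound nonneg)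
  then show ?thesis using ball by blast
qed

section \<open>Roots near the nodes\<close>

text \<open>
  Lagrange interpolation at the nodes: besides the node polynomial, which accounts for the leading
  term, the coefficients are the Weierstrass corrections.
\<close>

lemma poly_eq_weierstrass_sum:
  fixes f :: "'a::field poly" and x :: "'a ^ 'n::finite"
  assumes "degree f = CARD('n)" "inj (\<lambda>i. x $ i)"
  shows "poly f z = lead_coeff f *
    ((\<Prod>j\<in>UNIV. z - x $ j) + (\<Sum>k\<in>UNIV. weierstrass_corr f x $ k * (\<Prod>j\<in>UNIV - {k}. z - x $ j)))"
proof -
  define N where "N = (\<Prod>j\<in>UNIV. [:- (x $ j), 1:])"
  define L where "L = (\<lambda>k. \<Prod>j\<in>UNIV - {k}. [:- (x $ j), 1:])"
  define S where "S = (\<Sum>k\<in>UNIV. smult (weierstrass_corr f x $ k) (L k))"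
  have "f \<noteq> 0" using assms(1) by auto
  then have lc: "lead_coeff f \<noteq> 0" by simp
  have N: "degree N = CARD('n)" "lead_coeff N = 1"
    unfolding N_def by (simp add: degree_prod_sum_eq) (simp add: lead_coeff_prod)
  have "degree (L k) < CARD('n)" for k
    unfolding L_def by (simp add: degree_prod_sum_eq card_Diff_singleton)
  then have S: "degree S < CARD('n)"
    unfolding S_def by (intro degree_sum_less) (auto intro: le_less_trans[OF degree_smult_le])
  define g where "g = smult (lead_coeff f) (N + S)"
  have ev: "poly g z = lead_coeff f * ((\<Prod>j\<in>UNIV. z - x $ j) +
      (\<Sum>k\<in>UNIV. weierstrass_corr f x $ k * (\<Prod>j\<in>UNIV - {k}. z - x $ j)))" for z
    by (simp add: g_def N_def S_def L_def poly_prod poly_sum)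
  have "poly g (x $ i) = poly f (x $ i)" for i
  proof -
    have 0: "(\<Prod>j\<in>UNIV. x $ i - x $ j) = 0" by (auto simp: prod_zero_iff)
    have "(\<Prod>j\<in>UNIV - {k}. x $ i - x $ j) = 0" if "k \<noteq> i" for k
      using that by (auto simp: prod_zero_iff)
    then have "(\<Sum>k\<in>UNIV. weierstrass_corr f x $ k * (\<Prod>j\<in>UNIV - {k}. x $ i - x $ j))
        = weierstrass_corr f x $ i * (\<Prod>j\<in>UNIV - {i}. x $ i - x $ j)"
      by (subst sum.remove[of UNIV i]) (auto simp del: prod_zero_iff intro!: sum.neutral)
    moreover have "(\<Prod>j\<in>UNIV - {i}. x $ i - x $ j) \<noteq> 0"
      using assms(2) by (auto simp: prod_zero_iff inj_eq)
    ultimately show ?thesis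
      unfolding ev 0 using lc by (simp add: weierstrass_corr_def)
  qed
  then have "g = f"
    using assms N S lc
    by (intro poly_eqI_degree_lead_coeff[where n = "CARD('n)" and A = "range (\<lambda>i. x $ i)"])
      (auto simp: g_def card_image coeff_eq_0 intro!: degree_add_le)
  then show ?thesis using ev by simp
qed

text \<open>
  Singling out the node \<open>x $ i\<close> turns the root equation into a fixed point equation in the single
  unknown \<open>z\<close>, so that the roots near different nodes can be found independently.
\<close>

lemma poly_eq_node_factorization:
  fixes f :: "'a::field poly" and x :: "'a ^ 'n::finite"
  assumes "degree f = CARD('n)" "inj (\<lambda>i. x $ i)" "\<And>j. j \<noteq> i \<Longrightarrow> z \<noteq> x $ j"
  shows "poly f z = lead_coeff f * (\<Prod>j\<in>UNIV - {i}. z - x $ j) *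
    ((z - x $ i) * (1 + (\<Sum>j\<in>UNIV - {i}. weierstrass_corr f x $ j / (z - x $ j)))
      + weierstrass_corr f x $ i)"
proof -
  define W P where "W = weierstrass_corr f x" and "P = (\<Prod>j\<in>UNIV - {i}. z - x $ j)"
  have all: "(\<Prod>j\<in>UNIV. z - x $ j) = (z - x $ i) * P"
    by (simp add: P_def prod.remove[of UNIV i])
  have other: "(\<Prod>j\<in>UNIV - {k}. z - x $ j) = (z - x $ i) * P / (z - x $ k)" if "k \<noteq> i" for k
    unfolding all[symmetric] using assms(3)[OF that] by (simp add: prod.remove[of UNIV k])
  have "(\<Sum>k\<in>UNIV. W $ k * (\<Prod>j\<in>UNIV - {k}. z - x $ j))
      = W $ i * P + (\<Sum>k\<in>UNIV - {i}. W $ k * ((z - x $ i) * P / (z - x $ k)))"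
    by (subst sum.remove[of UNIV i]) (auto simp: P_def other[unfolded P_def] intro!: sum.cong)
  also have "\<dots> = W $ i * P + (z - x $ i) * P * (\<Sum>k\<in>UNIV - {i}. W $ k / (z - x $ k))"
    by (simp add: sum_distrib_left field_simps)
  finally have sum_eq: "(\<Sum>k\<in>UNIV. W $ k * (\<Prod>j\<in>UNIV - {k}. z - x $ j))
      = W $ i * P + (z - x $ i) * P * (\<Sum>k\<in>UNIV - {i}. W $ k / (z - x $ k))" .
  show ?thesis
    unfolding poly_eq_weierstrass_sum[OF assms(1,2)] all W_def[symmetric] P_def[symmetric] sum_eq
    by (simp add: algebra_simps)
qed

lemma sep_vec_le:
  fixes x :: "'a::field ^ 'n::finite"
  assumes "j \<noteq> i"
  shows "sep_vec v x $ i \<le> v (x $ i - x $ j)"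
  using assms by (auto simp: sep_vec_def intro!: Min_le)

context absolute_value
begin

lemma node_distance_pos:
  fixes x :: "'a ^ 'n::finite"
  assumes "inj (\<lambda>i. x $ i)" "j \<noteq> i"
  shows "0 < v (x $ i - x $ j)"
  using assms nonneg[of "x $ i - x $ j"] eq_0_iff[of "x $ i - x $ j"]
  by (auto simp: less_le inj_eq)

lemma sep_vec_pos:
  fixes x :: "'a ^ 'n::finite"
  assumes "inj (\<lambda>i. x $ i)" "2 \<le> CARD('n)"
  shows "0 < sep_vec v x $ i"
proof -
  have "{j. j \<noteq> i} \<noteq> {}"
  proof
    assume "{j. j \<noteq> i} = {}"
    then have "UNIV = {i}" by auto
    then have "CARD('n) = 1" by (metis card_1_singleton_iff One_nat_def)
    then show False using assms(2) by simp
  qed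
  then show ?thesis
    using node_distance_pos[OF assms(1)] by (auto simp: sep_vec_def Min_gr_iff)
qed

lemma sep_vec_le':
  fixes x :: "'a ^ 'n::finite"
  assumes "j \<noteq> i"
  shows "sep_vec v x $ j \<le> v (x $ i - x $ j)"
  using assms sep_vec_le[of i j v x] minus_commute by metis

lemma correction_eq_mult_sep_vec:
  fixes x W :: "'a ^ 'n::finite"
  assumes "inj (\<lambda>i. x $ i)" "2 \<le> CARD('n)"
  shows "v (W $ j) = vec_quot v W (sep_vec v x) $ j * sep_vec v x $ j"
  using sep_vec_pos[OF assms, of j] by (simp add: vec_quot_def)

lemma vec_quot_sep_vec_nonneg:
  fixes x W :: "'a ^ 'n::finite"
  assumes "inj (\<lambda>i. x $ i)" "2 \<le> CARD('n)"
  shows "0 \<le> vec_quot v W (sep_vec v x) $ j"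
  using sep_vec_pos[OF assms, of j] nonneg by (simp add: vec_quot_def)

end

lemma (in absolute_value) node_distance_ge:
  fixes x :: "'a ^ 'n::finite"
  assumes "j \<noteq> i" "0 \<le> \<tau>" "v (t - x $ i) \<le> \<tau> * sep_vec v x $ i"
  shows "(1 - \<tau>) * v (x $ i - x $ j) \<le> v (t - x $ j)"
proof -
  have "\<tau> * sep_vec v x $ i \<le> \<tau> * v (x $ i - x $ j)"
    using assms by (intro mult_left_mono sep_vec_le) auto
  then show ?thesis
    using assms triangle_diff[of "x $ i" "x $ j" t] minus_commute[of "x $ i" t]
    by (simp add: algebra_simps)
qed

context
  fixes v :: "'a::field \<Rightarrow> real" and x W :: "'a ^ 'n::finite" and i :: 'n and s R :: real
  assumes v: "absolute_value v" and inj: "inj (\<lambda>i. x $ i)" and card: "2 \<le> CARD('n)"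
    and R: "R < 1"
    and s: "(\<Sum>j\<in>UNIV - {i}. vec_quot v W (sep_vec v x) $ j) \<le> s"
begin

interpretation absolute_value v by (fact v)

lemmas sep_pos = sep_vec_pos[OF inj card]
  and correction_eq = correction_eq_mult_sep_vec[OF inj card]
  and correction_nonneg = vec_quot_sep_vec_nonneg[OF inj card]
  and node_distance_pos = node_distance_pos[OF inj]

text \<open>
  On the disc of relative radius \<open>\<tau>\<close> around \<open>x $ i\<close>, the \<open>j\<close>-th term of the denominator of the fixed
  point map costs at most \<open>w j / (1 - \<tau>)\<close>, where \<open>w j\<close> is the relative size of the correction: the
  disc keeps the distance \<open>(1 - \<tau>) * v (x $ i - x $ j)\<close> from \<open>x $ j\<close>, and both \<open>sep_vec v x $ i\<close> and
  \<open>sep_vec v x $ j\<close> are at most \<open>v (x $ i - x $ j)\<close>. That is why the hypothesis measures each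
  correction in units of the separation of its own node.
\<close>

lemma denominator_sum_le:
  assumes "0 \<le> \<tau>" "\<tau> \<le> R" "v (t - x $ i) \<le> \<tau> * sep_vec v x $ i"
  shows "v (\<Sum>j\<in>UNIV - {i}. W $ j / (t - x $ j)) \<le> s / (1 - \<tau>)"
proof -
  have "v (W $ j / (t - x $ j)) \<le> vec_quot v W (sep_vec v x) $ j / (1 - \<tau>)" if "j \<noteq> i" for j
  proof -
    have "v (W $ j / (t - x $ j)) \<le>
        (vec_quot v W (sep_vec v x) $ j * v (x $ i - x $ j)) / ((1 - \<tau>) * v (x $ i - x $ j))"
      unfolding divide correction_eq
      using node_distance_ge[OF that assms(1,3)] node_distance_pos[OF that] R assms(2)
        correction_nonneg sep_vec_le'[OF that]
      by (intro frac_le mult_left_mono) auto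
    then show ?thesis using node_distance_pos[OF that] by simp
  qed
  then have "v (\<Sum>j\<in>UNIV - {i}. W $ j / (t - x $ j))
      \<le> (\<Sum>j\<in>UNIV - {i}. vec_quot v W (sep_vec v x) $ j / (1 - \<tau>))"
    by (intro order_trans[OF sum_le] sum_mono) auto
  also have "\<dots> \<le> s / (1 - \<tau>)"
    unfolding sum_divide_distrib[symmetric] using s R assms by (intro divide_right_mono) auto
  finally show ?thesis .
qed

text \<open>
  A difference of two terms has two denominators, hence the square of \<open>v (x $ i - x $ j)\<close> below. One
  factor absorbs the separation of \<open>x $ j\<close>, the other is bounded by the separation of \<open>x $ i\<close>.
\<close>

lemma denominator_sum_lipschitz:
  assumes "0 \<le> \<sigma>" "\<sigma> \<le> R" "v (t - x $ i) \<le> \<sigma> * sep_vec v x $ i"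
    and "0 \<le> \<tau>" "\<tau> \<le> R" "v (u - x $ i) \<le> \<tau> * sep_vec v x $ i"
  shows "v ((\<Sum>j\<in>UNIV - {i}. W $ j / (u - x $ j)) - (\<Sum>j\<in>UNIV - {i}. W $ j / (t - x $ j)))
    \<le> s * v (u - t) / ((1 - \<sigma>) * (1 - \<tau>) * sep_vec v x $ i)"
proof -
  let ?w = "vec_quot v W (sep_vec v x)"
  define C where "C = v (u - t) / ((1 - \<sigma>) * (1 - \<tau>) * sep_vec v x $ i)"
  have C: "0 \<le> C" using R assms nonneg[of "u - t"] sep_pos[of i] by (simp add: C_def)
  have "v (W $ j / (u - x $ j) - W $ j / (t - x $ j)) \<le> ?w $ j * C" if "j \<noteq> i" for j
  proof -
    define \<rho> where "\<rho> = v (x $ i - x $ j)"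
    have \<rho>: "0 < \<rho>" "sep_vec v x $ i \<le> \<rho>" "sep_vec v x $ j \<le> \<rho>"
      using node_distance_pos[OF that] sep_vec_le[OF that] sep_vec_le'[OF that] by (simp_all add: \<rho>_def)
    have t: "(1 - \<sigma>) * \<rho> \<le> v (t - x $ j)" and u: "(1 - \<tau>) * \<rho> \<le> v (u - x $ j)"
      using node_distance_ge[OF that] assms by (simp_all add: \<rho>_def)
    have pos: "0 < (1 - \<sigma>) * \<rho>" "0 < (1 - \<tau>) * \<rho>" using \<rho> R assms by simp_all
    then have "t - x $ j \<noteq> 0" "u - x $ j \<noteq> 0"
      using t u eq_0_iff[of 0] by auto
    then have "W $ j / (u - x $ j) - W $ j / (t - x $ j)
        = W $ j * (t - u) / ((t - x $ j) * (u - x $ j))"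
      by (simp add: field_simps)
    then have "v (W $ j / (u - x $ j) - W $ j / (t - x $ j))
        = ?w $ j * sep_vec v x $ j * v (u - t) / (v (t - x $ j) * v (u - x $ j))"
      by (simp add: divide mult correction_eq minus_commute[of t u])
    also have "\<dots> \<le> ?w $ j * \<rho> * v (u - t) / (((1 - \<sigma>) * \<rho>) * ((1 - \<tau>) * \<rho>))"
    proof (rule frac_le)
      show "((1 - \<sigma>) * \<rho>) * ((1 - \<tau>) * \<rho>) \<le> v (t - x $ j) * v (u - x $ j)"
        using t u pos nonneg by (intro mult_mono) simp_all
      show "?w $ j * sep_vec v x $ j * v (u - t) \<le> ?w $ j * \<rho> * v (u - t)"
        using \<rho> nonneg correction_nonneg by (intro mult_right_mono mult_left_mono)
    qed (use \<rho> pos nonneg correction_nonneg in simp_all)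
    also have "\<dots> = ?w $ j * (v (u - t) / ((1 - \<sigma>) * (1 - \<tau>) * \<rho>))"
      using \<rho> by simp
    also have "\<dots> \<le> ?w $ j * C"
      unfolding C_def using \<rho> R assms nonneg sep_pos[of i] correction_nonneg
      by (intro mult_left_mono divide_left_mono) simp_all
    finally show ?thesis .
  qed
  then have "v (\<Sum>j\<in>UNIV - {i}. W $ j / (u - x $ j) - W $ j / (t - x $ j))
      \<le> (\<Sum>j\<in>UNIV - {i}. ?w $ j * C)"
    by (intro order_trans[OF sum_le] sum_mono) auto
  also have "\<dots> \<le> s * C"
    unfolding sum_distrib_right[symmetric] using s C by (intro mult_right_mono)
  finally show ?thesis by (simp add: sum_subtractf C_def)
qed

end

text \<open>
  The root in the disc of relative radius \<open>R\<close> solves the fixed point equation, and the denominator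
  bound on that disc turns this into an error bound by a multiple of the correction of the same
  node. This componentwise form is what passes to the \<open>p\<close>-norm.
\<close>

lemma root_near_node:
  fixes v :: "'a::alg_closed_field \<Rightarrow> real" and f :: "'a poly" and x :: "'a ^ 'n::finite"
    and w :: "real ^ 'n" and m s R :: real
  defines "w \<equiv> vec_quot v (weierstrass_corr f x) (sep_vec v x)"
  assumes v: "absolute_value v" and deg: "degree f = CARD('n)" and card: "2 \<le> CARD('n)"
    and inj: "inj (\<lambda>i. x $ i)"
    and m: "w $ i \<le> m" and s: "(\<Sum>j\<in>UNIV - {i}. w $ j) \<le> s" "s < 1 - R"
    and R: "0 \<le> R" "m / (1 - s / (1 - R)) \<le> R"
  shows "\<exists>\<zeta>. poly f \<zeta> = 0 \<and> v (x $ i - \<zeta>) / sep_vec v x $ i \<le> 1 / (1 - s / (1 - R)) * w $ i"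
proof -
  interpret absolute_value v by (fact v)
  define W d D where "W = weierstrass_corr f x" and "d = sep_vec v x $ i"
    and "D = (\<lambda>t. 1 + (\<Sum>j\<in>UNIV - {i}. W $ j / (t - x $ j)))"
  have s': "(\<Sum>j\<in>UNIV - {i}. vec_quot v W (sep_vec v x) $ j) \<le> s"
    using s(1) by (simp add: w_def W_def)
  have w: "0 \<le> w $ j" for j
    unfolding w_def by (rule vec_quot_sep_vec_nonneg[OF inj card])
  have s0: "0 \<le> s" using s(1) sum_nonneg[of "UNIV - {i}" "\<lambda>j. w $ j"] w by fastforce
  have R1: "R < 1" using s(2) s0 by linarith
  have d: "0 < d" unfolding d_def by (rule sep_vec_pos[OF inj card])
  have Wi: "v (W $ i) = w $ i * d"
    unfolding W_def w_def d_def by (rule correction_eq_mult_sep_vec[OF inj card])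
  note sum_le = denominator_sum_le[OF v inj card R1 s', folded d_def]
  have lower: "1 - s / (1 - \<tau>) \<le> v (D t)" if "0 \<le> \<tau>" "\<tau> \<le> R" "v (t - x $ i) \<le> \<tau> * d" for t \<tau>
    using sum_le[OF that] triangle_sub[of 1 "\<Sum>j\<in>UNIV - {i}. W $ j / (t - x $ j)"] one
    by (simp add: D_def)
  have upper: "v (D t) \<le> 1 + s / (1 - R)" if "v (t - x $ i) \<le> R * d" for t
    using sum_le[OF R(1) order_refl that] triangle[of 1 "\<Sum>j\<in>UNIV - {i}. W $ j / (t - x $ j)"] one
    by (simp add: D_def)
  have lip: "v (D u - D t) \<le> s * v (u - t) / ((1 - \<sigma>) * (1 - \<tau>) * d)"
    if "\<sigma> \<le> R" "\<tau> \<le> R" "v (t - x $ i) \<le> \<sigma> * d" "v (u - x $ i) \<le> \<tau> * d" for t u \<sigma> \<tau>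
  proof -
    have "0 \<le> \<sigma>" "0 \<le> \<tau>"
      using that(3,4) nonneg[of "t - x $ i"] nonneg[of "u - x $ i"] d
      by (smt (verit) mult_neg_pos)+
    then show ?thesis
      using denominator_sum_lipschitz[OF v inj card R1 s', folded d_def, of \<sigma> t \<tau> u] that
      by (simp add: D_def)
  qed
  have fact: "poly f t = lead_coeff f * (\<Prod>j\<in>UNIV - {i}. t - x $ j) * ((t - x $ i) * D t + W $ i)"
    and off: "j \<noteq> i \<Longrightarrow> t \<noteq> x $ j" if "v (t - x $ i) \<le> R * d" for t j
  proof -
    have ne: "t \<noteq> x $ j" if "j \<noteq> i" for j
    proof -
      have "0 < (1 - R) * v (x $ i - x $ j)"
        using R1 node_distance_pos[OF inj that] by simp
      also have "\<dots> \<le> v (t - x $ j)"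
        using node_distance_ge[OF that R(1)] \<open>v (t - x $ i) \<le> R * d\<close> by (simp add: d_def)
      finally show ?thesis using eq_0_iff[of 0] by auto
    qed
    then show "j \<noteq> i \<Longrightarrow> t \<noteq> x $ j" .
    show "poly f t = lead_coeff f * (\<Prod>j\<in>UNIV - {i}. t - x $ j) * ((t - x $ i) * D t + W $ i)"
      using poly_eq_node_factorization[OF deg inj ne] by (simp add: D_def W_def)
  qed
  have "f \<noteq> 0" using deg by auto
  then have lc: "lead_coeff f \<noteq> 0" by simp
  have "0 \<le> m" using w[of i] m by linarith
  moreover have "v (W $ i) \<le> m * d" using Wi m d by simp
  ultimately obtain t where t: "\<And>k. v (t k - x $ i) \<le> R * d"
    and lim: "(\<lambda>k. v ((t k - x $ i) * D (t k) + W $ i)) \<longlonglongrightarrow> 0"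
    using majorized_iteration[OF v d _ s0 s(2) R, of "W $ i" "x $ i" D] lower upper lip
    by blast
  define C where "C = v (lead_coeff f) * (\<Prod>j\<in>UNIV - {i}. R * d + v (x $ i - x $ j))"
  have f_le: "v (poly f (t k)) \<le> C * v ((t k - x $ i) * D (t k) + W $ i)" for k
  proof -
    have "v (t k - x $ j) \<le> R * d + v (x $ i - x $ j)" for j
      using triangle_diff[of "t k" "x $ j" "x $ i"] t[of k] by linarith
    then have "(\<Prod>j\<in>UNIV - {i}. v (t k - x $ j)) \<le> (\<Prod>j\<in>UNIV - {i}. R * d + v (x $ i - x $ j))"
      using nonneg by (intro prod_mono) simp
    then show ?thesis
      unfolding fact[OF t] mult prod C_def using nonneg by (intro mult_right_mono mult_left_mono)
  qed
  have C_lim: "(\<lambda>k. C * v ((t k - x $ i) * D (t k) + W $ i)) \<longlonglongrightarrow> 0"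
    using tendsto_mult_left[OF lim, of C] by simp
  have "(\<lambda>k. v (poly f (t k))) \<longlonglongrightarrow> 0"
    by (rule tendsto_sandwich[OF _ _ tendsto_const C_lim]) (simp_all add: nonneg f_le)
  then obtain \<zeta> where \<zeta>: "poly f \<zeta> = 0" "v (\<zeta> - x $ i) \<le> R * d"
    using root_in_disc_of_values_tendsto_zero[where t = t, OF v \<open>f \<noteq> 0\<close> t] by blast
  have "(\<zeta> - x $ i) * D \<zeta> + W $ i = 0"
    using \<zeta>(1) lc off[OF \<zeta>(2)] unfolding fact[OF \<zeta>(2)] by auto
  then have "(\<zeta> - x $ i) * D \<zeta> = - (W $ i)"
    by (simp add: eq_neg_iff_add_eq_0)
  then have "v (x $ i - \<zeta>) * v (D \<zeta>) = w $ i * d"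
    by (metis mult minus Wi minus_commute)
  moreover have "v (x $ i - \<zeta>) * (1 - s / (1 - R)) \<le> v (x $ i - \<zeta>) * v (D \<zeta>)"
    using lower[OF R(1) order_refl \<zeta>(2)] nonneg by (intro mult_left_mono)
  moreover have "0 < 1 - s / (1 - R)" using s R1 by (simp add: field_simps)
  ultimately have "v (x $ i - \<zeta>) / d \<le> 1 / (1 - s / (1 - R)) * w $ i"
    using d by (simp add: field_simps)
  then show ?thesis using \<zeta>(1) by (auto simp: d_def)
qed

section \<open>Distinctness and the bound in the \<open>p\<close>-norm\<close>

text \<open>
  Two nodes approximating the same root would be within the sum of the two errors of each other,
  while their distance is at least the separation of either.
\<close>

lemma approximated_points_distinct:
  fixes x \<xi> :: "'a::field ^ 'n::finite"
  assumes v: "absolute_value v" and inj: "inj (\<lambda>i. x $ i)" and card: "2 \<le> CARD('n)" and "i \<noteq> j"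
    and lt: "v (x $ i - \<xi> $ i) / sep_vec v x $ i + v (x $ j - \<xi> $ j) / sep_vec v x $ j < 1"
  shows "\<xi> $ i \<noteq> \<xi> $ j"
proof
  interpret absolute_value v by (fact v)
  assume eq: "\<xi> $ i = \<xi> $ j"
  define \<rho> where "\<rho> = v (x $ i - x $ j)"
  have d: "0 < sep_vec v x $ i" "0 < sep_vec v x $ j" by (rule sep_vec_pos[OF inj card])+
  have le: "sep_vec v x $ i \<le> \<rho>" "sep_vec v x $ j \<le> \<rho>"
    using assms(4) sep_vec_le[of j i v x] sep_vec_le[of i j v x] minus_commute[of "x $ i" "x $ j"]
    by (simp_all add: \<rho>_def)
  have "\<rho> \<le> v (x $ i - \<xi> $ i) + v (x $ j - \<xi> $ j)"
    unfolding \<rho>_def eq using triangle_diff[of "x $ i" "x $ j" "\<xi> $ j"]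
    by (simp add: minus_commute[of "\<xi> $ j" "x $ j"])
  also have "\<dots> = v (x $ i - \<xi> $ i) / sep_vec v x $ i * sep_vec v x $ i
      + v (x $ j - \<xi> $ j) / sep_vec v x $ j * sep_vec v x $ j"
    using d by simp
  also have "\<dots> \<le> v (x $ i - \<xi> $ i) / sep_vec v x $ i * \<rho> + v (x $ j - \<xi> $ j) / sep_vec v x $ j * \<rho>"
    using le d nonneg by (intro add_mono mult_left_mono) simp_all
  also have "\<dots> = (v (x $ i - \<xi> $ i) / sep_vec v x $ i + v (x $ j - \<xi> $ j) / sep_vec v x $ j) * \<rho>"
    by (simp add: distrib_right)
  also have "\<dots> < 1 * \<rho>"
    using lt le d by (intro mult_strict_right_mono) auto
  finally show False by simp
qed

text \<open>
  Rearranged, the hypothesis on \<open>e\<close> reads \<open>e * (1 - R) + a * e * R \<le> R * (1 - R)\<close>,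
  that is \<open>e \<le> R * (1 - a * e / (1 - R))\<close>. The conclusions say that the majorant map is defined at
  \<open>R\<close> and does not increase it.
\<close>

lemma majorant_bound:
  fixes a e R :: real
  assumes "1 \<le> a" "0 \<le> e" "0 \<le> R" "R < 1" and le: "e \<le> R * (1 - R) / (1 + (a - 1) * R)"
  shows "a * e < 1 - R" and "e / (1 - a * e / (1 - R)) \<le> R"
    and "e < R * (1 - R) / (1 + (a - 1) * R) \<Longrightarrow> e / (1 - a * e / (1 - R)) < R"
proof -
  have den: "0 < 1 + (a - 1) * R" using assms by (simp add: add_pos_nonneg)
  have 1: "e * (1 - R) + a * e * R \<le> R * (1 - R)"
    using le den by (simp add: field_simps)
  show 2: "a * e < 1 - R"
  proof (cases "e = 0 \<or> R = 0")
    case True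
    then show ?thesis using assms 1 by auto
  next
    case False
    then have "0 < e * (1 - R)" "0 < R" using assms by auto
    then have "(a * e) * R < (1 - R) * R" using 1 by (simp add: algebra_simps)
    then show ?thesis using \<open>0 < R\<close> by simp
  qed
  then have pos: "0 < 1 - a * e / (1 - R)" using assms by simp
  have eq: "R * (1 - a * e / (1 - R)) = (R * (1 - R) - a * e * R) / (1 - R)"
    using assms by (simp add: field_simps)
  have "e \<le> R * (1 - a * e / (1 - R))"
    unfolding eq using 1 assms by (simp add: pos_le_divide_eq)
  then show "e / (1 - a * e / (1 - R)) \<le> R" using pos by (simp add: pos_divide_le_eq)
  assume "e < R * (1 - R) / (1 + (a - 1) * R)"
  then have "e * (1 - R) + a * e * R < R * (1 - R)"
    using den by (simp add: field_simps)
  then have "e < R * (1 - a * e / (1 - R))"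
    unfolding eq using assms by (simp add: pos_less_divide_eq)
  then show "e / (1 - a * e / (1 - R)) < R" using pos by (simp add: pos_divide_less_eq)
qed

theorem theorem5p2:
  fixes v :: "'a::alg_closed_field \<Rightarrow> real"
    and f :: "'a poly"
    and x :: "'a ^ 'n::finite"
    and p q :: ereal
    and R a :: real
  assumes "absolute_value v"
    and "degree f = CARD('n)"
    and "CARD('n) \<ge> 2"
    and "inj (\<lambda>i. x $ i)"
    and "1 \<le> p"
    and "conjugate_exponents p q"
    and "a = (real CARD('n) - 1) powr real_of_ereal (1 / q)"
    and "0 \<le> R" and "R \<le> 1 / (1 + sqrt a)"
    and "p_norm p (vec_quot v (weierstrass_corr f x) (sep_vec v x))
           \<le> R * (1 - R) / (1 + (a - 1) * R)"
    and "CARD('n) = 2 \<and> p = \<infinity> \<and> R = 1 / (1 + sqrt a) \<Longrightarrow>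
         p_norm p (vec_quot v (weierstrass_corr f x) (sep_vec v x))
           < R * (1 - R) / (1 + (a - 1) * R)"
  shows "(\<forall>z. poly f z = 0 \<longrightarrow> order z f = 1) \<and>
         (\<exists>\<xi> :: 'a ^ 'n. root_vector f \<xi> \<and>
            p_norm p (vec_quot v (x - \<xi>) (sep_vec v x)) \<le> R \<and>
            (p_norm p (vec_quot v (weierstrass_corr f x) (sep_vec v x))
               < R * (1 - R) / (1 + (a - 1) * R) \<longrightarrow>
             p_norm p (vec_quot v (x - \<xi>) (sep_vec v x)) < R))"
proof -
  note v = assms(1) and deg = assms(2) and card = assms(3) and inj = assms(4) and p = assms(5)
    and R0 = assms(8) and R_le = assms(9) and small = assms(10)
  interpret absolute_value v by (fact v)
  define w where "w = vec_quot v (weierstrass_corr f x) (sep_vec v x)"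
  define e where "e = p_norm p w"
  define K where "K = 1 / (1 - a * e / (1 - R))"
  have w: "0 \<le> w $ i" for i
    unfolding w_def by (rule vec_quot_sep_vec_nonneg[OF inj card])
  have e: "0 \<le> e" unfolding e_def by (rule p_norm_nonneg)
  have "0 \<le> real_of_ereal (1 / q)"
    using assms(6) unfolding conjugate_exponents_def
    by (cases q) (auto simp: one_ereal_def)
  then have a1: "1 \<le> a"
    unfolding assms(7) using card by (intro ge_one_powr_ge_zero) auto
  have half: "R \<le> 1 / 2"
  proof -
    have "1 \<le> sqrt a" using a1 by simp
    then have "1 / (1 + sqrt a) \<le> 1 / 2" by (intro frac_le) auto
    then show ?thesis using R_le by linarith
  qed
  then have R1: "R < 1" by simp
  note bound = majorant_bound[OF a1 e R0 R1 small[folded w_def e_def]]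
  have K: "0 \<le> K" using bound(1) R1 by (simp add: K_def)
  have "\<exists>\<zeta>. poly f \<zeta> = 0 \<and> v (x $ i - \<zeta>) / sep_vec v x $ i \<le> K * w $ i" for i
    unfolding K_def w_def
  proof (rule root_near_node[OF v deg card inj _ _ bound(1) R0 bound(2)], fold w_def)
    show "w $ i \<le> e"
      using abs_component_le_p_norm[OF p, of w i] by (simp add: e_def)
    show "(\<Sum>j\<in>UNIV - {i}. w $ j) \<le> a * e"
      using sum_other_components_le_p_norm[OF p assms(6) card, of w i] w
      by (simp add: e_def assms(7))
  qed
  then obtain r where r: "\<And>i. poly f (r i) = 0"
    and r_le: "\<And>i. v (x $ i - r i) / sep_vec v x $ i \<le> K * w $ i"
    by metis
  define \<xi> where "\<xi> = (\<chi> i. r i)"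
  define u where "u = vec_quot v (x - \<xi>) (sep_vec v x)"
  have u_eq: "u $ i = v (x $ i - \<xi> $ i) / sep_vec v x $ i" for i
    by (simp add: u_def vec_quot_def)
  have u0: "0 \<le> u $ i" for i
    using sep_vec_pos[OF inj card] nonneg by (simp add: u_eq less_imp_le)
  have "u $ i \<le> K * w $ i" for i
    using r_le[of i] by (simp add: u_eq \<xi>_def)
  then have "p_norm p u \<le> K * p_norm p w"
    using u0 w by (intro p_norm_le_mult[OF p K]) simp
  then have u_le: "p_norm p u \<le> e / (1 - a * e / (1 - R))"
    by (simp add: K_def e_def)
  then have u_R: "p_norm p u \<le> R" using bound(2) by linarith
  have u_less: "p_norm p u < R" if "e < R * (1 - R) / (1 + (a - 1) * R)"
    using u_le bound(3)[OF that] by linarith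
  have "inj (\<lambda>i. \<xi> $ i)"
  proof (rule injI, rule ccontr)
    fix i j assume eq: "\<xi> $ i = \<xi> $ j" and ij: "i \<noteq> j"
    have "1 \<le> u $ i + u $ j"
      using approximated_points_distinct[OF v inj card ij, of \<xi>] eq by (metis u_eq not_le)
    moreover have "u $ i \<le> p_norm p u" "u $ j \<le> p_norm p u"
      using abs_component_le_p_norm[OF p, of u i] abs_component_le_p_norm[OF p, of u j] by simp_all
    \<comment> \<open>Only the borderline case remains, in which the two closed discs could touch.\<close>
    ultimately have ui: "u $ i = 1 / 2" and uj: "u $ j = 1 / 2" and R: "R = 1 / 2"
      and norm: "p_norm p u = 1 / 2"
      using u_R half by linarith+
    have inf: "p = \<infinity>"
    proof (rule ccontr)
      assume "p \<noteq> \<infinity>"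
      then have "1 / 2 < p_norm p u"
        using ui uj by (intro p_norm_gt_of_two_components[OF p _ ij]) simp_all
      then show False using norm by simp
    qed
    have "\<not> 1 < sqrt a"
    proof
      assume "1 < sqrt a"
      then have "1 / (1 + sqrt a) < 1 / 2" by (intro frac_less2) auto
      then show False using R_le R by linarith
    qed
    then have "a \<le> 1" by simp
    then have a: "a = 1" using a1 by linarith
    have "real_of_ereal (1 / q) = 1"
      using conjugate_exponent_inverse[OF assms(6)] inf by simp
    then have "a = real CARD('n) - 1"
      unfolding assms(7) using card by simp
    then have "CARD('n) = 2" using a by simp
    moreover have "R = 1 / (1 + sqrt a)" unfolding a R by simp
    ultimately have "e < R * (1 - R) / (1 + (a - 1) * R)"
      unfolding e_def w_def using inf by (intro assms(11) conjI)
    then show False using u_less norm R by simp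
  qed
  note dist = distinct_roots_root_vector_simple[OF deg this]
  have roots: "poly f (\<xi> $ i) = 0" for i using r by (simp add: \<xi>_def)
  show ?thesis
  proof (intro conjI exI allI impI)
    show "order z f = 1" if "poly f z = 0" for z
      by (rule dist(2)[OF roots that])
    show "root_vector f \<xi>" by (rule dist(1)[OF roots])
  qed (use u_R u_less in \<open>simp_all add: u_def e_def w_def\<close>)
qed

end
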